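(* For every real $\kappa\in[1,\infty)$, every positive integer $d$, and every set $A\subseteq\{0,1\}^d$ one has \[ E_{\kappa}(A) \leq |A|^{r}, \qquad\text{where } r=r(\kappa):=\log_2\binom{2\kappa}{\kappa}. \] Besides the trivial cases $|A|\leq 1$, equality is also attained for some sets with $|A|>1$; for example, it is attained when $A=\{0,1\}^d$.
   Context: For a real number $\kappa\in[1,\infty)$ and a finite set $A\subset\mathbb{Z}^d$, the generalized additive energy is \[ E_{\kappa}(A) := \int_{\mathbb{T}^d} \Big|\sum_{x\in A} e^{-2\pi i x\cdot\xi}\Big|^{2\kappa} \,\mathrm{d}\xi, \] where $\mathbb{T}^d=(\mathbb{R}/\mathbb{Z})^d$ carries the Haar probability measure. $|A|$ denotes the cardinality of $A$. The generalized binomial coefficient is $\binom{a}{b}:=\frac{\Gamma(a+1)}{\Gamma(b+1)\Gamma(a-b+1)}$ for real $a,b$ with $\min\{a,b,a-b\}>-1$. *)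

theory Defs
  imports "HOL-Analysis.Analysis" "HOL-Probability.Infinite_Product_Measure"
begin

text \<open>
  Vectors indexed by \<open>{..<d}\<close> are extensional functions on \<open>nat\<close>. The circle \<open>\<real>/\<int>\<close> is represented
  by its fundamental domain \<open>[0,1)\<close>, on which Haar probability measure is Lebesgue measure; Haar
  probability measure on \<open>(\<real>/\<int>)\<^sup>d\<close> is the \<open>d\<close>-fold product of it.
\<close>

definition torus :: "nat \<Rightarrow> (nat \<Rightarrow> real) measure" where
  "torus d = (\<Pi>\<^sub>M i\<in>{..<d}. restrict_space lborel {0..<1})"

lemma space_torus: "space (torus d) = ({..<d} \<rightarrow>\<^sub>E {0..<1})"
  by (simp add: torus_def space_PiM space_restrict_space)

lemma prob_space_torus: "prob_space (torus d)"
  unfolding torus_def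
  by (rule prob_space_PiM) (auto intro!: prob_spaceI simp: space_restrict_space emeasure_restrict_space)

definition additive_energy :: "nat \<Rightarrow> real \<Rightarrow> (nat \<Rightarrow> int) set \<Rightarrow> real" where
  "additive_energy d \<kappa> A =
     (\<integral>\<xi>. norm (\<Sum>x\<in>A. cis (- 2 * pi * (\<Sum>j<d. of_int (x j) * \<xi> j))) powr (2 * \<kappa>) \<partial>torus d)"

text \<open>The library's \<open>gchoose\<close> only admits a natural number as lower argument.\<close>

definition gen_binomial :: "real \<Rightarrow> real \<Rightarrow> real" where
  "gen_binomial a b = Gamma (a + 1) / (Gamma (b + 1) * Gamma (a - b + 1))"

definition energy_exponent :: "real \<Rightarrow> real" where
  "energy_exponent \<kappa> = log 2 (gen_binomial (2 * \<kappa>) \<kappa>)"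

definition binary_cube :: "nat \<Rightarrow> (nat \<Rightarrow> int) set" where
  "binary_cube d = ({..<d} \<rightarrow>\<^sub>E {0, 1})"

end

theory Submission
  imports Defs
begin

text \<open>
  Write \<open>r = energy_exponent \<kappa>\<close> and \<open>\<alpha> = 2 \<kappa> / r\<close>. Splitting off the last coordinate, \<open>A\<close> decomposes into
  slices \<open>A\<^sub>0\<close>, \<open>A\<^sub>1\<close> with trigonometric sums \<open>f\<^sub>0\<close>, \<open>f\<^sub>1\<close>, and the integral over the last
  variable is the mean \<open>M\<close> of \<open>|a + e\<^sup>i\<^sup>\<theta> b|\<^sup>2\<^sup>\<kappa>\<close> over the circle, where \<open>a = |f\<^sub>0|\<close> and \<open>b = |f\<^sub>1|\<close>. The two-point
  inequality \<open>M \<le> (a\<^sup>\<alpha> + b\<^sup>\<alpha>)\<^sup>r\<close>, an equality for \<open>a = b\<close> by a Beta integral, and the convexity of \<open>x\<^sup>r\<close>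
  then give the bound by induction on \<open>d\<close>.

  For the two-point inequality, normalise \<open>a = e\<^sup>t\<^sup>/\<^sup>2\<close>, \<open>b = e\<^sup>-\<^sup>t\<^sup>/\<^sup>2\<close> and let \<open>D t\<close> be the difference of the logarithms of
  the two sides. It vanishes at \<open>0\<close> and at infinity and is positive for large \<open>t\<close>. The mean
  satisfies a second order linear differential equation, so at a critical point of \<open>D\<close> the sign of
  \<open>D''\<close> is that of \<open>\<alpha> / 2 - \<kappa> sinh ((\<alpha> - 1) t) / sinh t\<close>, which is increasing in \<open>t\<close>; hence a negative minimum
  cannot be followed by a maximum.
\<close>

subsection \<open>Moments of \<open>cosh t + cos \<theta>\<close>\<close>

text \<open>For \<open>a = exp (t / 2)\<close> and \<open>b = exp (- t / 2)\<close> one has |a +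
  e^(i \<theta>) b|^2 = 2 (cosh t + cos \<theta>). Hence
  \<open>2 powr q * cos_moment q t / pi\<close> is the mean of the 2q-th power of this modulus over
  the circle; by evenness in \<theta> half the circle suffices.\<close>

definition cos_moment :: "real \<Rightarrow> real \<Rightarrow> real" where
  "cos_moment q t = integral {0..pi} (\<lambda>\<theta>. (cosh t + cos \<theta>) powr q)"

lemma cosh_plus_cos_nonneg: "0 \<le> cosh t + cos \<theta>" for t \<theta> :: real
  using cosh_real_ge_1[of t] cos_ge_minus_one[of \<theta>] by linarith

lemma cosh_plus_cos_pos: "t \<noteq> 0 \<Longrightarrow> 0 < cosh t + cos \<theta>" for t \<theta> :: real
  using cosh_real_ge_1[of t] cosh_real_one_iff[of t] cos_ge_minus_one[of \<theta>] by linarith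

lemma continuous_on_cosh_plus_cos_powr:
  assumes "0 < q \<or> t \<noteq> 0"
  shows "continuous_on S (\<lambda>\<theta>. (cosh t + cos \<theta> :: real) powr q)"
  using assms cosh_plus_cos_pos[of t] cosh_plus_cos_nonneg[of t]
  by (intro continuous_on_powr' continuous_intros) (auto simp: less_imp_neq[THEN not_sym])

lemma continuous_on_cos_moment:
  assumes "0 < q"
  shows "continuous_on S (cos_moment q)"
proof -
  have "continuous_on (UNIV \<times> cbox 0 pi) (\<lambda>(t, \<theta>). (cosh t + cos \<theta> :: real) powr q)"
    unfolding split_beta using assms cosh_plus_cos_nonneg
    by (intro continuous_on_powr' continuous_intros) auto
  then have "continuous_on UNIV (\<lambda>t. integral (cbox 0 pi) (\<lambda>\<theta>. (cosh t + cos \<theta> :: real) powr q))"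
    by (rule integral_continuous_on_param)
  then show ?thesis
    by (auto simp: cos_moment_def[abs_def] intro: continuous_on_subset)
qed

lemma cos_moment_pos:
  assumes "0 < q \<or> t \<noteq> 0"
  shows "0 < cos_moment q t"
proof -
  let ?f = "\<lambda>\<theta>. (cosh t + cos \<theta> :: real) powr q"
  have "0 \<le> cos_moment q t"
    unfolding cos_moment_def by (rule integral_nonneg)
      (auto intro!: integrable_continuous_real continuous_on_cosh_plus_cos_powr assms)
  moreover have "cos_moment q t \<noteq> 0"
  proof
    assume "cos_moment q t = 0"
    then have "\<forall>\<theta>\<in>{0..pi}. ?f \<theta> = 0"
      unfolding cos_moment_def
      using integral_eq_0_iff[OF continuous_on_cosh_plus_cos_powr[OF assms], of 0 pi] by simp
    then have "?f 0 = 0"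
      by (rule bspec) auto
    then show False
      using cosh_real_ge_1[of t] by simp
  qed
  ultimately show ?thesis by simp
qed

text \<open>Differentiation under the integral sign. For positive \<open>t\<close> the base stays
  positive; at \<open>t = 0\<close> it vanishes for \<open>\<theta> = pi\<close>, where negative
  powers are singular.\<close>

lemma has_field_derivative_cos_moment:
  assumes "0 < t"
  shows "(cos_moment q has_field_derivative q * sinh t * cos_moment (q - 1) t) (at t)"
proof -
  let ?f' = "\<lambda>t \<theta>. q * sinh t * (cosh t + cos \<theta> :: real) powr (q - 1)"
  have "((\<lambda>t. integral (cbox 0 pi) (\<lambda>\<theta>. (cosh t + cos \<theta>) powr q))
      has_field_derivative integral (cbox 0 pi) (?f' t)) (at t within {0<..})"
  proof (rule leibniz_rule_field_derivative)
    fix x \<theta> :: real assume "x \<in> {0<..}" 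
    then show "((\<lambda>x. (cosh x + cos \<theta>) powr q) has_field_derivative ?f' x \<theta>) (at x within {0<..})"
      using cosh_plus_cos_pos[of x \<theta>]
      by (auto intro!: derivative_eq_intros simp: powr_diff)
  next
    fix x :: real assume "x \<in> {0<..}"
    then show "(\<lambda>\<theta>. (cosh x + cos \<theta>) powr q) integrable_on cbox 0 pi"
      by (intro integrable_continuous continuous_on_cosh_plus_cos_powr) auto
  next
    show "continuous_on ({0<..} \<times> cbox 0 pi) (\<lambda>(x, \<theta>). ?f' x \<theta>)"
      unfolding split_beta using cosh_plus_cos_pos
      by (intro continuous_on_powr' continuous_intros) 
        (auto simp: less_imp_neq[THEN not_sym] intro: less_imp_le)
  qed (use assms in auto)
  then have "(cos_moment q has_field_derivative integral {0..pi} (?f' t)) (at t within {0<..})"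
    by (simp add: cos_moment_def[abs_def])
  moreover have "at t within {0<..} = at t"
    by (rule at_within_open) (use assms in auto)
  ultimately show ?thesis
    by (simp add: cos_moment_def)
qed

text \<open>Integrate the \<open>\<theta>\<close>-derivative of \<open>sin \<theta> (cosh t + cos \<theta>)\<^sup>q\<^sup>-\<^sup>1\<close>, which vanishes at both end points,
  and write \<open>cos \<theta>\<close> and \<open>sin\<^sup>2 \<theta>\<close> in terms of \<open>cosh t + cos \<theta>\<close>.\<close>

lemma cos_moment_recurrence:
  assumes "0 < t"
  shows "(q - 1) * (sinh t)\<^sup>2 * cos_moment (q - 2) t
    = (2 * q - 1) * cosh t * cos_moment (q - 1) t - q * cos_moment q t"
proof -
  let ?X = "\<lambda>\<theta>. cosh t + cos \<theta> :: real"
  let ?g = "\<lambda>\<theta>. q * ?X \<theta> powr q - (2 * q - 1) * cosh t * ?X \<theta> powr (q - 1)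
     + (q - 1) * (sinh t)\<^sup>2 * ?X \<theta> powr (q - 2)"
  have X: "0 < ?X \<theta>" for \<theta>
    using cosh_plus_cos_pos assms by simp
  have "(?g has_integral sin pi * ?X pi powr (q - 1) - sin 0 * ?X 0 powr (q - 1)) {0..pi}"
  proof (rule fundamental_theorem_of_calculus)
    fix \<theta> :: real
    \<comment> \<open>Every power involved is a polynomial in \<open>?X \<theta>\<close> times this
      lowest one, so the derivative identity becomes ring arithmetic.\<close>
    define u where "u = ?X \<theta> powr (q - 2)"
    have pw: "?X \<theta> powr (q - 1) = ?X \<theta> * u" "?X \<theta> powr q = (?X \<theta>)\<^sup>2 * u"
      using X[of \<theta>] powr_add[of "?X \<theta>" 1 "q - 2"] powr_add[of "?X \<theta>" 2 "q - 2"]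
      by (simp_all add: u_def)
    have "(sin \<theta>)\<^sup>2 = 1 - (cos \<theta>)\<^sup>2" "(sinh t)\<^sup>2 = (cosh t)\<^sup>2 - 1"
      by (auto simp: sin_squared_eq cosh_square_eq)
    then have *: "cos \<theta> * (?X \<theta> * u) - (q - 1) * (sin \<theta>)\<^sup>2 * u = ?g \<theta>"
      unfolding pw u_def[symmetric] by (simp only:) (simp add: algebra_simps power2_eq_square)
    have "((\<lambda>\<theta>. sin \<theta> * ?X \<theta> powr (q - 1)) has_field_derivative
        cos \<theta> * (?X \<theta> * u) - (q - 1) * (sin \<theta>)\<^sup>2 * u) (at \<theta> within {0..pi})"
      unfolding pw[symmetric] using X[of \<theta>]
      by (auto intro!: derivative_eq_intros simp: u_def power2_eq_square)
    then show "((\<lambda>\<theta>. sin \<theta> * ?X \<theta> powr (q - 1)) has_vector_derivative ?g \<theta>) (at \<theta> within {0..pi})"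
      unfolding * has_real_derivative_iff_has_vector_derivative .
  qed simp
  then have "(?g has_integral 0) {0..pi}"
    by simp
  moreover have "((\<lambda>\<theta>. ?X \<theta> powr s) has_integral cos_moment s t) {0..pi}" for s
    unfolding cos_moment_def using assms
    by (intro integrable_integral integrable_continuous_real continuous_on_cosh_plus_cos_powr) auto
  then have "(?g has_integral q * cos_moment q t - (2 * q - 1) * cosh t * cos_moment (q - 1) t
     + (q - 1) * (sinh t)\<^sup>2 * cos_moment (q - 2) t) {0..pi}"
    by (intro has_integral_add has_integral_diff has_integral_mult_right)
  ultimately have "0 = q * cos_moment q t - (2 * q - 1) * cosh t * cos_moment (q - 1) t
     + (q - 1) * (sinh t)\<^sup>2 * cos_moment (q - 2) t"
    by (rule has_integral_unique)
  then show ?thesis by linarith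
qed

section \<open>Elementary inequalities for powers and the exponential\<close>

text \<open>Bernoulli's inequality for real exponents, from Young's inequality with weights
  \<open>1 / p\<close> and \<open>1 - 1 / p\<close> applied to \<open>(1 + y) powr p\<close> and
  \<open>1\<close>.\<close>

lemma powr_ge_tangent:
  fixes p y :: real
  assumes "1 \<le> p" "-1 \<le> y"
  shows "1 + p * y \<le> (1 + y) powr p"
proof (cases "y = -1")
  case True
  then show ?thesis using assms by simp
next
  case False
  have "((1 + y) powr p) powr (1 / p) * 1 powr (1 - 1 / p) \<le> 1 / p * (1 + y) powr p + (1 - 1 / p) * 1"
    by (rule Youngs_inequality_0) (use assms False in auto)
  then have "1 + y \<le> 1 / p * (1 + y) powr p + (1 - 1 / p)"
    using assms by (simp add: powr_powr)
  then have "p * (1 + y) \<le> p * (1 / p * (1 + y) powr p + (1 - 1 / p))"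
    using assms by (intro mult_left_mono) auto
  then show ?thesis
    using assms by (simp add: distrib_left right_diff_distrib)
qed

text \<open>Jensen's inequality for the \<open>r\<close>-th power at the points \<open>x / m\<close>
  and \<open>y / n\<close> with weights proportional to \<open>m\<close> and \<open>n\<close>. In
  the induction, \<open>m\<close> and \<open>n\<close> are the cardinalities of the two
  slices.\<close>

lemma powr_sum_le_weighted:
  fixes m n x y r :: real
  assumes "1 \<le> r" "0 < m" "0 < n" "0 \<le> x" "0 \<le> y"
  shows "(x + y) powr r \<le> (m + n) powr (r - 1) * (m powr (1 - r) * x powr r + n powr (1 - r) * y powr r)"
proof (cases "x + y = 0")
  case True
  then show ?thesis using assms by simp
next
  case False
  \<comment> \<open>The weighted mean of \<open>x / m\<close> and \<open>y / n\<close>. Each summand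
    is bounded below by the tangent at \<open>s\<close>, and the linear parts cancel in the
    sum.\<close>
  define s where "s = (x + y) / (m + n)"
  have s: "0 < s" using False assms by (simp add: s_def)
  have *: "a * s powr r * (1 + r * (z / (a * s) - 1)) \<le> a powr (1 - r) * z powr r"
    if "0 < a" "0 \<le> z" for a z
  proof -
    have "1 + r * (z / (a * s) - 1) \<le> (1 + (z / (a * s) - 1)) powr r"
      by (rule powr_ge_tangent) (use that s assms in auto)
    also have "\<dots> = z powr r / (a powr r * s powr r)"
      using that s by (simp add: powr_divide powr_mult)
    finally have "a * s powr r * (1 + r * (z / (a * s) - 1)) \<le> a * s powr r * (z powr r / (a powr r * s powr r))"
      using that s by (intro mult_left_mono) auto
    also have "\<dots> = a powr (1 - r) * z powr r"
      using that s by (simp add: powr_diff)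
    finally show ?thesis .
  qed
  have "(x + y) powr r = (m + n) powr (r - 1) * ((m + n) * s powr r)"
    using assms by (simp add: s_def powr_divide powr_diff)
  also have "(m + n) * s powr r = m * s powr r * (1 + r * (x / (m * s) - 1)) + n * s powr r * (1 + r * (y / (n * s) - 1))"
  proof -
    have "m * (1 + r * (x / (m * s) - 1)) + n * (1 + r * (y / (n * s) - 1)) = m + n + r * ((x + y) / s - (m + n))"
      using s assms by (simp add: field_simps)
    also have "\<dots> = m + n"
      using s assms False by (simp add: s_def)
    finally have "(m * (1 + r * (x / (m * s) - 1)) + n * (1 + r * (y / (n * s) - 1))) * s powr r = (m + n) * s powr r"
      by simp
    moreover have "(m * u + n * v) * s powr r = m * s powr r * u + n * s powr r * v" for u v
      by (simp only: algebra_simps)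
    ultimately show ?thesis
      by simp
  qed
  also have "\<dots> \<le> m powr (1 - r) * x powr r + n powr (1 - r) * y powr r"
    by (intro add_mono * assms)
  finally show ?thesis
    using assms by (simp add: mult_left_mono)
qed

text \<open>For negative \<open>x\<close>, invert the quadratic Taylor lower bound for
  \<open>exp (- x)\<close>.\<close>

lemma exp_le_quadratic:
  fixes x :: real
  assumes "\<bar>x\<bar> \<le> 1"
  shows "exp x \<le> 1 + x + x\<^sup>2"
proof (cases "0 \<le> x")
  case True
  then show ?thesis using exp_bound assms by simp
next
  case False
  have "1 - x + x\<^sup>2 / 2 \<le> exp (- x)"
    using exp_lower_Taylor_quadratic[of "-x"] False by simp
  moreover have "0 < 1 - x + x\<^sup>2 / 2"
    using False by (simp add: add_pos_nonneg)
  ultimately have "1 / exp (- x) \<le> 1 / (1 - x + x\<^sup>2 / 2)"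
    by (intro divide_left_mono) auto
  then have "exp x \<le> 1 / (1 - x + x\<^sup>2 / 2)"
    by (simp only: exp_minus inverse_eq_divide) simp
  also have "\<dots> \<le> 1 + x + x\<^sup>2"
  proof -
    have "1 \<le> (1 + x + x\<^sup>2) * (1 - x + x\<^sup>2 / 2)"
    proof -
      have "(1 + x + x\<^sup>2) * (1 - x + x\<^sup>2 / 2) - 1 = x\<^sup>2 / 2 * (1 - x + x\<^sup>2)"
        by (simp add: field_simps power2_eq_square)
      also have "\<dots> \<ge> 0" using False by simp
      finally show ?thesis by simp
    qed
    then show ?thesis
      using False by (simp add: pos_divide_le_eq add_pos_nonneg)
  qed
  finally show ?thesis .
qed

section \<open>Bounds for the moments at infinity and at zero\<close>

lemma has_integral_cos_0_pi: "((\<lambda>\<theta>. a + b * cos \<theta>) has_integral pi * a) {0..pi}"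
proof -
  have "((\<lambda>\<theta>. a + b * cos \<theta>) has_integral (a * pi + b * sin pi) - (a * 0 + b * sin 0)) {0..pi}"
    by (rule fundamental_theorem_of_calculus)
      (auto intro!: derivative_eq_intros simp: has_real_derivative_iff_has_vector_derivative[symmetric])
  then show ?thesis by (simp add: mult.commute)
qed

text \<open>The bracket is |1 + e^(-t + i \<theta>)|^2, which is close to 1 for large
  \<open>t\<close>; the bounds below expand its \<open>q\<close>-th power around 1.\<close>

lemma two_cosh_plus_cos: "2 * (cosh t + cos \<theta>) = exp t * (1 + (exp (-2 * t) + 2 * exp (-t) * cos \<theta>))"
  for t \<theta> :: real
proof -
  have "exp t * (1 + (exp (-2 * t) + 2 * exp (-t) * cos \<theta>))
      = exp t + exp t * exp (-2 * t) + 2 * (exp t * exp (-t)) * cos \<theta>"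
    by (simp only: algebra_simps)
  also have "exp t * exp (-2 * t) = exp (-t)"
    by (simp add: exp_add[symmetric])
  also have "exp t * exp (-t) = 1"
    by (simp add: exp_add[symmetric])
  finally show ?thesis
    by (simp add: cosh_field_def)
qed

lemma has_integral_cos_moment_scaled:
  assumes "0 < q"
  shows "((\<lambda>\<theta>. exp (q * t) * (1 + (exp (-2 * t) + 2 * exp (-t) * cos \<theta>)) powr q)
    has_integral 2 powr q * cos_moment q t) {0..pi}"
proof -
  have "((\<lambda>\<theta>. (cosh t + cos \<theta>) powr q) has_integral cos_moment q t) {0..pi}"
    unfolding cos_moment_def using assms
    by (intro integrable_integral integrable_continuous_real continuous_on_cosh_plus_cos_powr) auto
  then have "((\<lambda>\<theta>. 2 powr q * (cosh t + cos \<theta>) powr q) has_integral 2 powr q * cos_moment q t) {0..pi}"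
    by (rule has_integral_mult_right)
  moreover have "2 powr q * (cosh t + cos \<theta>) powr q
      = exp (q * t) * (1 + (exp (-2 * t) + 2 * exp (-t) * cos \<theta>)) powr q" for \<theta>
  proof -
    have "2 powr q * (cosh t + cos \<theta>) powr q = (2 * (cosh t + cos \<theta>)) powr q"
      using cosh_plus_cos_nonneg[of t \<theta>] by (subst powr_mult) auto
    also have "\<dots> = exp t powr q * (1 + (exp (-2 * t) + 2 * exp (-t) * cos \<theta>)) powr q"
      unfolding two_cosh_plus_cos by (subst powr_mult) auto
    finally show ?thesis
      by (simp add: powr_def)
  qed
  ultimately show ?thesis by simp
qed

lemma one_plus_exp_cos_nonneg: "0 \<le> 1 + (exp (-2 * t) + 2 * exp (-t) * cos \<theta>)" for t \<theta> :: real
proof -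
  have "0 \<le> exp t * (1 + (exp (-2 * t) + 2 * exp (-t) * cos \<theta>))"
    unfolding two_cosh_plus_cos[symmetric] using cosh_plus_cos_nonneg[of t \<theta>] by simp
  then show ?thesis by (simp add: zero_le_mult_iff)
qed

text \<open>Bernoulli's inequality under the integral: the cosine term has mean zero, and the
  remaining correction is positive and is dropped.\<close>

lemma cos_moment_lower:
  assumes "1 \<le> q"
  shows "exp (q * t) * pi \<le> 2 powr q * cos_moment q t"
proof -
  have "((\<lambda>\<theta>. exp (q * t) * ((1 + q * exp (-2 * t)) + (2 * q * exp (-t)) * cos \<theta>))
      has_integral exp (q * t) * (pi * (1 + q * exp (-2 * t)))) {0..pi}"
    by (intro has_integral_mult_right has_integral_cos_0_pi)
  then have "exp (q * t) * (pi * (1 + q * exp (-2 * t))) \<le> 2 powr q * cos_moment q t"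
  proof (rule has_integral_le[OF _ has_integral_cos_moment_scaled])
    fix \<theta> :: real
    have "1 + q * (exp (-2 * t) + 2 * exp (-t) * cos \<theta>) \<le> (1 + (exp (-2 * t) + 2 * exp (-t) * cos \<theta>)) powr q"
      using one_plus_exp_cos_nonneg[of t \<theta>] by (intro powr_ge_tangent assms) linarith
    then have "(1 + q * exp (-2 * t)) + (2 * q * exp (-t)) * cos \<theta>
        \<le> (1 + (exp (-2 * t) + 2 * exp (-t) * cos \<theta>)) powr q"
      by (simp add: algebra_simps)
    then show "exp (q * t) * ((1 + q * exp (-2 * t)) + (2 * q * exp (-t)) * cos \<theta>)
        \<le> exp (q * t) * (1 + (exp (-2 * t) + 2 * exp (-t) * cos \<theta>)) powr q"
      by (intro mult_left_mono) auto
  qed (use assms in auto)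
  moreover have "exp (q * t) * pi \<le> exp (q * t) * (pi * (1 + q * exp (-2 * t)))"
    using assms by simp
  ultimately show ?thesis by linarith
qed

text \<open>With y the deviation of the bracket from 1, use (1 + y)^q \<le> e^(q y) \<le> 1 + q y +
  (q y)^2. The cosine term again has mean zero, so the error is of order
  \<open>exp (-2 * t)\<close>: the part \<open>q\<close> comes from the linear term, and
  \<open>9 * q\<^sup>2\<close> from |q y| \<le> 3 q e^(-t), which the second hypothesis keeps below
  1.\<close>

lemma cos_moment_upper:
  assumes "1 \<le> q" "3 * q * exp (-t) \<le> 1"
  shows "2 powr q * cos_moment q t \<le> exp (q * t) * pi * (1 + (q + 9 * q\<^sup>2) * exp (-2 * t))"
proof -
  let ?y = "\<lambda>\<theta>. exp (-2 * t) + 2 * exp (-t) * cos \<theta>"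
  have "((\<lambda>\<theta>. exp (q * t) * ((1 + (q + 9 * q\<^sup>2) * exp (-2 * t)) + (2 * q * exp (-t)) * cos \<theta>))
      has_integral exp (q * t) * (pi * (1 + (q + 9 * q\<^sup>2) * exp (-2 * t)))) {0..pi}"
    by (intro has_integral_mult_right has_integral_cos_0_pi)
  then have "2 powr q * cos_moment q t \<le> exp (q * t) * (pi * (1 + (q + 9 * q\<^sup>2) * exp (-2 * t)))"
  proof (rule has_integral_le[OF has_integral_cos_moment_scaled, rotated])
    fix \<theta> :: real
    have e: "exp (-2 * t) = exp (-t) * exp (-t)"
      by (simp add: exp_add[symmetric])
    have small: "exp (-t) \<le> 1"
    proof -
      have "1 * exp (-t) \<le> 3 * q * exp (-t)"
        by (rule mult_right_mono) (use assms in auto)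
      then show ?thesis using assms by linarith
    qed
    have "\<bar>?y \<theta>\<bar> \<le> exp (-2 * t) + 2 * exp (-t) * \<bar>cos \<theta>\<bar>"
      by (simp add: abs_mult order_trans[OF abs_triangle_ineq])
    also have "\<dots> \<le> 1 * exp (-t) + 2 * exp (-t) * 1"
      unfolding e using small by (intro add_mono mult_mono) auto
    finally have y: "\<bar>?y \<theta>\<bar> \<le> 3 * exp (-t)"
      by simp
    have "\<bar>q * ?y \<theta>\<bar> \<le> q * (3 * exp (-t))"
      using y assms by (simp only: abs_mult) (intro mult_mono, auto)
    then have qy: "\<bar>q * ?y \<theta>\<bar> \<le> 3 * q * exp (-t)"
      by simp
    have "(1 + ?y \<theta>) powr q \<le> exp (?y \<theta>) powr q"
      using one_plus_exp_cos_nonneg assms by (intro powr_mono2) auto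
    also have "\<dots> = exp (q * ?y \<theta>)"
      by (simp add: powr_def)
    also have "\<dots> \<le> 1 + q * ?y \<theta> + (q * ?y \<theta>)\<^sup>2"
      by (rule exp_le_quadratic) (use qy assms in linarith)
    also have "(q * ?y \<theta>)\<^sup>2 \<le> (3 * q * exp (-t))\<^sup>2"
      using power_mono[OF qy, of 2] by simp
    also have "1 + q * ?y \<theta> + (3 * q * exp (-t))\<^sup>2
        = (1 + (q + 9 * q\<^sup>2) * exp (-2 * t)) + (2 * q * exp (-t)) * cos \<theta>"
      unfolding e by (simp add: algebra_simps power2_eq_square)
    finally show "exp (q * t) * (1 + ?y \<theta>) powr q
        \<le> exp (q * t) * ((1 + (q + 9 * q\<^sup>2) * exp (-2 * t)) + (2 * q * exp (-t)) * cos \<theta>)"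
      by simp
  qed (use assms in auto)
  then show ?thesis by (simp add: mult.assoc)
qed

text \<open>From \<open>1 + cos \<theta> \<le> 2\<close>; this will give
  \<open>energy_exponent q \<le> 2 * q\<close>.\<close>

lemma cos_moment_0_upper:
  assumes "0 < q"
  shows "2 powr q * cos_moment q 0 \<le> 2 powr (2 * q) * pi"
proof -
  have "cos_moment q 0 \<le> integral {0..pi} (\<lambda>\<theta>. 2 powr q)"
    unfolding cos_moment_def
  proof (rule integral_le)
    fix \<theta> :: real
    show "(cosh 0 + cos \<theta>) powr q \<le> 2 powr q"
      using assms cosh_plus_cos_nonneg[of 0 \<theta>] cos_le_one[of \<theta>]
      by (intro powr_mono2) auto
  qed (intro integrable_continuous_real continuous_on_cosh_plus_cos_powr disjI1 assms continuous_on_const)+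
  then have "2 powr q * cos_moment q 0 \<le> 2 powr q * (pi * 2 powr q)"
    by simp
  also have "\<dots> = 2 powr (2 * q) * pi"
    unfolding mult_2[of q] powr_add by simp
  finally show ?thesis .
qed

text \<open>Bernoulli's inequality integrated. It is strict because the two sides differ by
  \<open>q - 1\<close> at \<open>\<theta> = pi\<close>. This will give
  \<open>q < energy_exponent q\<close>.\<close>

lemma cos_moment_0_lower:
  assumes "1 < q"
  shows "pi < cos_moment q 0"
proof -
  let ?f = "\<lambda>\<theta>. (cosh 0 + cos \<theta>) powr q - (1 + q * cos \<theta>) :: real"
  have cont: "continuous_on {0..pi} ?f"
    using assms by (intro continuous_intros continuous_on_cosh_plus_cos_powr) auto
  have nonneg: "0 \<le> ?f \<theta>" for \<theta>
    using powr_ge_tangent[of q "cos \<theta>"] assms by simp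
  have "((\<lambda>\<theta>. (cosh 0 + cos \<theta>) powr q) has_integral cos_moment q 0) {0..pi}"
    unfolding cos_moment_def using assms
    by (intro integrable_integral integrable_continuous_real continuous_on_cosh_plus_cos_powr) auto
  then have "(?f has_integral cos_moment q 0 - pi * 1) {0..pi}"
    by (intro has_integral_diff has_integral_cos_0_pi)
  then have I: "integral {0..pi} ?f = cos_moment q 0 - pi"
    by (simp add: integral_unique)
  have "integral {0..pi} ?f \<noteq> 0"
  proof
    assume "integral {0..pi} ?f = 0"
    then have "\<forall>\<theta>\<in>{0..pi}. ?f \<theta> = 0"
      using integral_eq_0_iff[OF cont] nonneg by simp
    then have "?f pi = 0"
      by (rule bspec) auto
    then show False using assms by simp
  qed
  moreover have "0 \<le> integral {0..pi} ?f"
    using nonneg cont by (intro integral_nonneg integrable_continuous_real) auto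
  ultimately show ?thesis
    using I by simp
qed

subsection \<open>The two-point inequality\<close>

text \<open>The numerator \<open>?N\<close> of the derivative vanishes at 0 and has derivative
  \<open>(b * b - 1) * (sinh (b * y) * sinh y)\<close>, which is negative on the positive
  axis.\<close>

lemma sinh_ratio_strict_decreasing:
  fixes b s t :: real
  assumes "0 < b" "b < 1" "0 < s" "s < t"
  shows "sinh (b * t) / sinh t < sinh (b * s) / sinh s"
proof -
  let ?N = "\<lambda>x. b * cosh (b * x) * sinh x - sinh (b * x) * cosh x"
  have N: "?N x < 0" if "0 < x" for x
  proof -
    have "?N x < ?N 0"
    proof (rule DERIV_neg_imp_decreasing_open[OF that])
      fix y :: real assume "0 < y" "y < x"
      have "(?N has_field_derivative (b * b - 1) * (sinh (b * y) * sinh y)) (at y)"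
        by (auto intro!: derivative_eq_intros simp: algebra_simps)
      moreover have "b * b < 1 * 1"
        using assms by (intro mult_strict_mono) auto
      then have "(b * b - 1) * (sinh (b * y) * sinh y) < 0"
        using \<open>0 < y\<close> assms by (intro mult_neg_pos mult_pos_pos) auto
      ultimately show "\<exists>d. (?N has_field_derivative d) (at y) \<and> d < 0"
        by blast
    qed (intro continuous_intros)
    then show ?thesis by simp
  qed
  show ?thesis
  proof (rule DERIV_neg_imp_decreasing[OF \<open>s < t\<close>])
    fix x :: real assume "s \<le> x" "x \<le> t"
    then have x: "0 < x" using assms by simp
    then have "((\<lambda>x. sinh (b * x) / sinh x) has_field_derivative ?N x / (sinh x * sinh x)) (at x)"
      by (auto intro!: derivative_eq_intros simp: algebra_simps)
    moreover have "?N x / (sinh x * sinh x) < 0"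
      using N[OF x] x by (intro divide_neg_pos mult_pos_pos) auto
    ultimately show "\<exists>d. ((\<lambda>x. sinh (b * x) / sinh x) has_field_derivative d) (at x) \<and> d < 0"
      by blast
  qed
qed

text \<open>A negative second derivative would make \<open>f'\<close> negative just to the right of
  \<open>x\<close>, so \<open>f\<close> would drop below its minimum.\<close>

lemma second_derivative_nonneg_at_min:
  fixes f f' :: "real \<Rightarrow> real"
  assumes "0 < d" and min: "\<And>y. \<bar>x - y\<bar> < d \<Longrightarrow> f x \<le> f y"
    and f: "\<And>y. \<bar>x - y\<bar> < d \<Longrightarrow> (f has_field_derivative f' y) (at y)"
    and f': "(f' has_field_derivative f'') (at x)" and "f' x = 0"
  shows "0 \<le> f''"
proof (rule ccontr)
  assume "\<not> 0 \<le> f''"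
  then obtain e where e: "0 < e" "\<And>h. 0 < h \<Longrightarrow> h < e \<Longrightarrow> f' (x + h) < f' x"
    using DERIV_neg_dec_right[OF f'] by auto
  define h where "h = min d e / 2"
  have h: "0 < h" "h < d" "h < e"
    using \<open>0 < d\<close> \<open>0 < e\<close> by (auto simp: h_def)
  have "f (x + h) < f x"
  proof (rule DERIV_neg_imp_decreasing_open[where f = f])
    fix y assume "x < y" "y < x + h"
    then show "\<exists>D. (f has_field_derivative D) (at y) \<and> D < 0"
      using f[of y] e(2)[of "y - x"] h \<open>f' x = 0\<close> by (intro exI[of _ "f' y"]) auto
  next
    show "continuous_on {x..x + h} f"
      using h by (intro continuous_at_imp_continuous_on ballI DERIV_isCont[OF f]) auto
  qed (use h in auto)
  then show False
    using min[of "x + h"] h by simp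
qed

text \<open>The condition \<open>at_0\<close> encodes \<alpha> = 2 \<kappa> / r: it says that the
  two sides of the two-point inequality agree for \<open>a = b\<close>.\<close>

locale log_gap =
  fixes \<kappa> \<alpha> :: real
  assumes \<kappa>: "1 < \<kappa>" and \<alpha>: "1 \<le> \<alpha>" "\<alpha> < 2"
    and at_0: "2 powr \<kappa> * cos_moment \<kappa> 0 = 2 powr (2 * \<kappa> / \<alpha>) * pi"
begin

text \<open>The function D of the introduction, with \<open>2 * \<kappa> / \<alpha>\<close> in the
  role of r.\<close>

definition gap :: "real \<Rightarrow> real" where
  "gap t = 2 * \<kappa> / \<alpha> * ln (2 * cosh (\<alpha> * t / 2)) - ln (2 powr \<kappa> * cos_moment \<kappa> t / pi)"

definition gap' :: "real \<Rightarrow> real" where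
  "gap' t = \<kappa> * tanh (\<alpha> * t / 2) - \<kappa> * (sinh t * cos_moment (\<kappa> - 1) t / cos_moment \<kappa> t)"

lemma cos_moment_\<kappa>_pos: "0 < cos_moment \<kappa> t"
  using cos_moment_pos \<kappa> by simp

lemma gap_0: "gap 0 = 0"
  by (simp add: gap_def at_0 ln_powr)

lemma continuous_on_gap: "continuous_on S gap"
proof -
  have "2 powr \<kappa> * cos_moment \<kappa> t / pi \<noteq> 0" "2 * cosh (\<alpha> * t / 2) \<noteq> 0" for t
    using cos_moment_\<kappa>_pos[of t] cosh_real_pos[of "\<alpha> * t / 2"] by (auto simp del: cosh_real_pos)
  then show ?thesis
    unfolding gap_def[abs_def] using \<kappa>
    by (intro continuous_intros continuous_on_cos_moment) auto
qed

lemma has_field_derivative_gap: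
  assumes "0 < t"
  shows "(gap has_field_derivative gap' t) (at t)"
proof -
  have "((\<lambda>t. 2 * \<kappa> / \<alpha> * ln (2 * cosh (\<alpha> * t / 2))) has_field_derivative \<kappa> * tanh (\<alpha> * t / 2)) (at t)"
    using \<alpha> by (auto intro!: derivative_eq_intros simp: tanh_def)
  moreover have "((\<lambda>t. ln (2 powr \<kappa> * cos_moment \<kappa> t / pi)) has_field_derivative
      \<kappa> * (sinh t * cos_moment (\<kappa> - 1) t / cos_moment \<kappa> t)) (at t)"
    using cos_moment_\<kappa>_pos[of t]
    by (auto intro!: derivative_eq_intros has_field_derivative_cos_moment assms)
  ultimately show ?thesis
    unfolding gap_def[abs_def] gap'_def by (rule DERIV_diff)
qed

text \<open>By the recurrence, \<open>w = sinh t * cos_moment (\<kappa> - 1) t / cos_moment \<kappa> t\<close> satisfies the Riccati equation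
  \<open>w' = \<kappa> (2 coth t * w - w\<^sup>2 - 1)\<close>.\<close>

lemma has_field_derivative_gap':
  assumes t: "0 < t" and crit: "gap' t = 0"
  shows "(gap' has_field_derivative
    \<kappa> / (cosh (\<alpha> * t / 2))\<^sup>2 * (\<alpha> / 2 - \<kappa> * (sinh ((\<alpha> - 1) * t) / sinh t))) (at t)"
proof -
  define K K1 K2 where "K = cos_moment \<kappa> t" and "K1 = cos_moment (\<kappa> - 1) t" and "K2 = cos_moment (\<kappa> - 2) t"
  define w where "w = sinh t * K1 / K"
  define C S where "C = cosh (\<alpha> * t / 2)" and "S = sinh (\<alpha> * t / 2)"
  have K: "0 < K" and C: "0 < C" and sinh: "0 < sinh t"
    using cos_moment_\<kappa>_pos t by (auto simp: K_def C_def)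
  have CS: "C\<^sup>2 = S\<^sup>2 + 1"
    by (simp add: C_def S_def cosh_square_eq)
  \<comment> \<open>At a critical point \<open>w\<close> equals
    \<open>tanh (\<alpha> * t / 2)\<close>, so the Riccati equation yields an expression free of
    moments.\<close>
  have w: "w = S / C"
    using crit \<kappa> unfolding gap'_def w_def K_def K1_def C_def S_def tanh_def
    by (simp add: right_diff_distrib[symmetric] del: times_divide_eq_right)
  have "((\<lambda>t. tanh (\<alpha> * t / 2)) has_field_derivative \<alpha> / 2 * (1 - (S / C)\<^sup>2)) (at t)"
    unfolding C_def S_def tanh_def[symmetric] by (auto intro!: derivative_eq_intros)
  moreover have "((\<lambda>t. sinh t * cos_moment (\<kappa> - 1) t / cos_moment \<kappa> t) has_field_derivative
      ((cosh t * K1 + sinh t * ((\<kappa> - 1) * sinh t * K2)) * K - (sinh t * K1) * (\<kappa> * sinh t * K1)) / (K * K)) (at t)"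
    using K
    by (auto intro!: derivative_eq_intros has_field_derivative_cos_moment t
        simp: K_def K1_def K2_def diff_diff_add)
  moreover have "((cosh t * K1 + sinh t * ((\<kappa> - 1) * sinh t * K2)) * K - (sinh t * K1) * (\<kappa> * sinh t * K1)) / (K * K)
      = \<kappa> * (2 * (cosh t / sinh t) * w - 1 - w\<^sup>2)"
  proof -
    \<comment> \<open>The recurrence eliminates the lowest moment \<open>K2\<close>.\<close>
    have "sinh t * ((\<kappa> - 1) * sinh t * K2) = (2 * \<kappa> - 1) * cosh t * K1 - \<kappa> * K"
      using cos_moment_recurrence[OF t, of \<kappa>]
      by (simp add: K_def K1_def K2_def power2_eq_square mult_ac)
    moreover have "sinh t * K1 = w * K"
      using K by (simp add: w_def)
    moreover from this have "K1 = w * K / sinh t"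
      using sinh by (simp add: field_simps)
    ultimately have "((cosh t * K1 + sinh t * ((\<kappa> - 1) * sinh t * K2)) * K - (sinh t * K1) * (\<kappa> * sinh t * K1)) / (K * K)
        = ((cosh t * (w * K / sinh t) + ((2 * \<kappa> - 1) * cosh t * (w * K / sinh t) - \<kappa> * K)) * K
            - (w * K) * (\<kappa> * (w * K))) / (K * K)"
      by (simp only: mult.assoc)
    also have "\<dots> = \<kappa> * (2 * (cosh t / sinh t) * w - 1 - w\<^sup>2)"
      using K sinh by (simp add: field_simps power2_eq_square)
    finally show ?thesis .
  qed
  ultimately have "(gap' has_field_derivative
      \<kappa> * (\<alpha> / 2 * (1 - (S / C)\<^sup>2)) - \<kappa> * (\<kappa> * (2 * (cosh t / sinh t) * w - 1 - w\<^sup>2))) (at t)"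
    unfolding gap'_def[abs_def] by (intro DERIV_diff DERIV_cmult) (simp_all only:)
  moreover have "\<kappa> * (\<alpha> / 2 * (1 - (S / C)\<^sup>2)) - \<kappa> * (\<kappa> * (2 * (cosh t / sinh t) * w - 1 - w\<^sup>2))
      = \<kappa> / C\<^sup>2 * (\<alpha> / 2 - \<kappa> * (sinh ((\<alpha> - 1) * t) / sinh t))"
  proof -
    \<comment> \<open>The addition and duplication formulas then produce exactly the combination of
      \<open>S\<close>, \<open>C\<close> and coth t left by the Riccati equation.\<close>
    have "(\<alpha> - 1) * t = 2 * (\<alpha> * t / 2) - t"
      by (simp add: algebra_simps)
    then have "sinh ((\<alpha> - 1) * t) = 2 * S * C * cosh t - (C\<^sup>2 + S\<^sup>2) * sinh t"
      by (simp only: sinh_diff sinh_double cosh_double C_def S_def)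
    then have e: "sinh ((\<alpha> - 1) * t) / sinh t = 2 * S * C * (cosh t / sinh t) - (C\<^sup>2 + S\<^sup>2)"
      using sinh by (simp add: field_simps)
    have "1 - (S / C)\<^sup>2 = (C\<^sup>2 - S\<^sup>2) / C\<^sup>2"
      using C by (simp add: power_divide diff_divide_distrib)
    also have "C\<^sup>2 - S\<^sup>2 = 1"
      using CS by simp
    finally have "1 - (S / C)\<^sup>2 = 1 / C\<^sup>2" .
    moreover have "2 * (cosh t / sinh t) * w - 1 - w\<^sup>2 = (2 * S * C * (cosh t / sinh t) - (C\<^sup>2 + S\<^sup>2)) / C\<^sup>2"
      unfolding w using C by (simp add: field_simps power2_eq_square)
    ultimately have "\<kappa> * (\<alpha> / 2 * (1 - (S / C)\<^sup>2)) - \<kappa> * (\<kappa> * (2 * (cosh t / sinh t) * w - 1 - w\<^sup>2))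
        = \<kappa> * (\<alpha> / 2 * (1 / C\<^sup>2)) - \<kappa> * (\<kappa> * ((2 * S * C * (cosh t / sinh t) - (C\<^sup>2 + S\<^sup>2)) / C\<^sup>2))"
      by (simp only:)
    also have "\<dots> = \<kappa> / C\<^sup>2 * (\<alpha> / 2 - \<kappa> * (sinh ((\<alpha> - 1) * t) / sinh t))"
      unfolding e by (simp add: right_diff_distrib diff_divide_distrib mult.commute)
    finally show ?thesis .
  qed
  ultimately show ?thesis
    by (simp add: C_def)
qed

lemma ln_cosh_split: "2 * \<kappa> / \<alpha> * ln (2 * cosh (\<alpha> * t / 2)) = \<kappa> * t + 2 * \<kappa> / \<alpha> * ln (1 + exp (- \<alpha> * t))"
proof -
  have "exp (\<alpha> * t / 2) * exp (- \<alpha> * t) = exp (- (\<alpha> * t / 2))"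
    by (simp add: exp_add[symmetric])
  then have "2 * cosh (\<alpha> * t / 2) = exp (\<alpha> * t / 2) * (1 + exp (- \<alpha> * t))"
    by (simp add: cosh_field_def distrib_left)
  also have "ln \<dots> = \<alpha> * t / 2 + ln (1 + exp (- \<alpha> * t))"
    by (subst ln_mult_pos) (auto intro: add_pos_pos)
  finally show ?thesis
    using \<alpha> by (simp only:) (simp add: distrib_left)
qed

text \<open>The leading terms \<open>\<kappa> * t\<close> of the two logarithms cancel. The bound
  forces the gap below any given positive number for large \<open>t\<close>.\<close>

lemma gap_upper: "gap t \<le> 2 * \<kappa> / \<alpha> * exp (- \<alpha> * t)"
proof -
  have "\<kappa> * t = ln (exp (\<kappa> * t))"
    by simp
  also have "\<dots> \<le> ln (2 powr \<kappa> * cos_moment \<kappa> t / pi)"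
    using cos_moment_lower[of \<kappa> t] \<kappa> by (intro ln_mono) (auto simp: field_simps)
  moreover have "ln (1 + exp (- \<alpha> * t)) \<le> exp (- \<alpha> * t)"
    by (rule ln_add_one_self_le_self) simp
  then have "2 * \<kappa> / \<alpha> * ln (1 + exp (- \<alpha> * t)) \<le> 2 * \<kappa> / \<alpha> * exp (- \<alpha> * t)"
    by (rule mult_left_mono) (use \<kappa> \<alpha> in auto)
  ultimately show ?thesis
    unfolding gap_def ln_cosh_split by linarith
qed

text \<open>Once \<open>\<kappa> * t\<close> cancels, the first logarithm contributes at least
  \<open>\<kappa> / \<alpha> * exp (- \<alpha> * t)\<close> and the second takes away at most a
  multiple of \<open>exp (-2 * t)\<close>; \<alpha> < 2 decides for large \<open>t\<close>.\<close>

lemma gap_eventually_pos: "eventually (\<lambda>t. 0 < gap t) at_top"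
proof -
  define c where "c = \<kappa> + 9 * \<kappa>\<^sup>2"
  have c: "0 < c"
    using \<kappa> by (auto simp: c_def intro!: add_pos_pos)
  \<comment> \<open>The second threshold meets the hypothesis of \<open>cos_moment_upper\<close>;
    the third makes \<open>c * exp (-2 * t)\<close> smaller than
    \<open>\<kappa> / \<alpha> * exp (- \<alpha> * t)\<close>.\<close>
  have pos: "0 < gap t" if t: "0 \<le> t" "ln (3 * \<kappa>) \<le> t" "ln (c * \<alpha> / \<kappa>) / (2 - \<alpha>) < t" for t
  proof -
    have "3 * \<kappa> \<le> exp t"
      using exp_mono[OF t(2)] \<kappa> by simp
    then have "3 * \<kappa> * exp (- t) \<le> 1"
      by (simp add: exp_minus field_simps)
    then have "2 powr \<kappa> * cos_moment \<kappa> t \<le> exp (\<kappa> * t) * pi * (1 + c * exp (-2 * t))"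
      unfolding c_def using \<kappa> by (intro cos_moment_upper) auto
    then have "ln (2 powr \<kappa> * cos_moment \<kappa> t / pi) \<le> ln (exp (\<kappa> * t) * (1 + c * exp (-2 * t)))"
      using cos_moment_\<kappa>_pos[of t] by (intro ln_mono) (auto simp: field_simps)
    also have "\<dots> = \<kappa> * t + ln (1 + c * exp (-2 * t))"
      using c by (subst ln_mult_pos) (auto intro: add_pos_pos)
    also have "ln (1 + c * exp (-2 * t)) \<le> c * exp (-2 * t)"
      using c by (intro ln_add_one_self_le_self) auto
    finally have 1: "ln (2 powr \<kappa> * cos_moment \<kappa> t / pi) \<le> \<kappa> * t + c * exp (-2 * t)"
      by simp
    define x where "x = exp (- \<alpha> * t)"
    have x: "0 < x" "x \<le> 1"
      using t \<alpha> by (auto simp: x_def)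
    have "ln (1 / (1 + x)) \<le> 1 / (1 + x) - 1"
      using x by (intro ln_le_minus_one) auto
    also have "1 / (1 + x) - 1 \<le> - (x / 2)"
      using x by (simp add: field_simps)
    finally have "x / 2 \<le> ln (1 + x)"
      using x by (simp add: ln_div)
    then have 2: "2 * \<kappa> / \<alpha> * (x / 2) \<le> 2 * \<kappa> / \<alpha> * ln (1 + x)"
      by (rule mult_left_mono) (use \<kappa> \<alpha> in auto)
    have "ln (c * \<alpha> / \<kappa>) < (2 - \<alpha>) * t"
      using t \<alpha> by (simp add: field_simps)
    then have "c * \<alpha> / \<kappa> < exp ((2 - \<alpha>) * t)"
      using c \<alpha> \<kappa> by (metis exp_less_mono exp_ln divide_pos_pos mult_pos_pos less_le_trans zero_less_one order_less_trans)
    then have "c * \<alpha> / \<kappa> * exp (-2 * t) < exp ((2 - \<alpha>) * t) * exp (-2 * t)"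
      by (intro mult_strict_right_mono) auto
    also have "exp ((2 - \<alpha>) * t) * exp (-2 * t) = x"
      by (simp add: x_def exp_add[symmetric] algebra_simps)
    finally have "c * exp (-2 * t) < 2 * \<kappa> / \<alpha> * (x / 2)"
      using \<alpha> \<kappa> by (simp add: field_simps)
    with 1 2 show ?thesis
      unfolding gap_def ln_cosh_split x_def by linarith
  qed
  have "eventually (\<lambda>t. 0 \<le> t \<and> ln (3 * \<kappa>) \<le> t \<and> ln (c * \<alpha> / \<kappa>) / (2 - \<alpha>) < t) at_top"
    by (intro eventually_conj eventually_ge_at_top eventually_gt_at_top)
  then show ?thesis
    by (rule eventually_mono) (use pos in blast)
qed

lemma gap_nonneg:
  assumes "0 \<le> t1"
  shows "0 \<le> gap t1"
proof (rule ccontr)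
  assume "\<not> 0 \<le> gap t1"
  then have neg: "gap t1 < 0" by simp
  have "eventually (\<lambda>t. t1 < t \<and> 0 < gap t) at_top"
    by (intro eventually_conj eventually_gt_at_top gap_eventually_pos)
  then obtain T where T: "t1 < T" "0 < gap T"
    by (auto simp: eventually_at_top_linorder)
  \<comment> \<open>The minimum is negative while \<open>gap 0 = 0\<close> and
    \<open>gap T > 0\<close>, so it is attained in the interior.\<close>
  obtain a where a: "a \<in> {0..T}" and min: "\<And>y. y \<in> {0..T} \<Longrightarrow> gap a \<le> gap y"
    using continuous_attains_inf[OF compact_Icc _ continuous_on_gap, of 0 T] T assms by force
  have "gap a < 0"
    using min[of t1] neg T assms by simp
  then have a': "0 < a" "a < T"
    using a T gap_0 by (auto simp: order.order_iff_strict)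
  \<comment> \<open>Chosen so that \<open>gap_upper\<close> gives \<open>gap T' < gap T\<close>. A
    maximum over \<open>{a..T'}\<close> then lies neither at \<open>T'\<close> nor at
    \<open>a\<close>, where the gap is negative.\<close>
  define T' where "T' = max (T + 1) (ln (2 * \<kappa> / \<alpha> / gap T) / \<alpha> + 1)"
  have T': "T < T'" "gap T' < gap T"
  proof -
    have "ln (2 * \<kappa> / \<alpha> / gap T) < \<alpha> * T'"
    proof -
      have "ln (2 * \<kappa> / \<alpha> / gap T) / \<alpha> < T'"
        by (simp add: T'_def less_max_iff_disj)
      then show ?thesis
        using \<alpha> by (simp only: pos_divide_less_eq mult.commute)
    qed
    then have "exp (ln (2 * \<kappa> / \<alpha> / gap T)) < exp (\<alpha> * T')"
      by simp
    then have "2 * \<kappa> / \<alpha> * exp (- \<alpha> * T') < gap T"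
      using \<kappa> \<alpha> T by (simp add: exp_minus field_simps)
    then show "gap T' < gap T"
      using gap_upper[of T'] by simp
  qed (simp add: T'_def)
  obtain b where b: "b \<in> {a..T'}" and max: "\<And>y. y \<in> {a..T'} \<Longrightarrow> gap y \<le> gap b"
    using continuous_attains_sup[OF compact_Icc _ continuous_on_gap, of a T'] T' a' by force
  have "gap T \<le> gap b"
    using max[of T] T' a' by simp
  then have b': "a < b" "b < T'"
    using b T T' \<open>gap a < 0\<close> by (auto simp: order.order_iff_strict)
  define da where "da = min a (T - a)"
  have da: "0 < da" "\<And>y. \<bar>a - y\<bar> < da \<Longrightarrow> 0 < y"
    using a' by (auto simp: da_def)
  have min': "gap a \<le> gap y" if "\<bar>a - y\<bar> < da" for y
    by (rule min) (use that in \<open>auto simp: da_def\<close>)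
  define db where "db = min (b - a) (T' - b)"
  have db: "0 < db" "\<And>y. \<bar>b - y\<bar> < db \<Longrightarrow> 0 < y"
    using a' b' by (auto simp: db_def)
  have max': "gap y \<le> gap b" if "\<bar>b - y\<bar> < db" for y
    by (rule max) (use that in \<open>auto simp: db_def\<close>)
  have "gap' a = 0"
    by (rule DERIV_local_min[OF has_field_derivative_gap[OF a'(1)] da(1)]) (simp add: min')
  have "gap' b = 0"
    by (rule DERIV_local_max[OF has_field_derivative_gap db(1)]) (use a' b' max' in auto)
  let ?g = "\<lambda>t. \<alpha> / 2 - \<kappa> * (sinh ((\<alpha> - 1) * t) / sinh t)"
  have "0 \<le> \<kappa> / (cosh (\<alpha> * a / 2))\<^sup>2 * ?g a"
    by (rule second_derivative_nonneg_at_min[OF da(1) min' has_field_derivative_gap[OF da(2)]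
          has_field_derivative_gap'[OF a'(1) \<open>gap' a = 0\<close>]]) (use \<open>gap' a = 0\<close> in auto)
  then have ga: "0 \<le> ?g a"
    using \<kappa> by (simp add: zero_le_mult_iff zero_le_divide_iff)
  have "0 \<le> - (\<kappa> / (cosh (\<alpha> * b / 2))\<^sup>2 * ?g b)"
  proof (rule second_derivative_nonneg_at_min[OF db(1), where f = "\<lambda>t. - gap t" and f' = "\<lambda>t. - gap' t"])
    show "((\<lambda>t. - gap' t) has_field_derivative - (\<kappa> / (cosh (\<alpha> * b / 2))\<^sup>2 * ?g b)) (at b)"
      using a' b' \<open>gap' b = 0\<close> by (intro DERIV_minus has_field_derivative_gap') auto
  qed (use max' \<open>gap' b = 0\<close> in \<open>auto intro!: DERIV_minus has_field_derivative_gap db(2)\<close>)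
  then have gb: "?g b \<le> 0"
  proof -
    have "0 < \<kappa> / (cosh (\<alpha> * b / 2))\<^sup>2"
      using \<kappa> by simp
    then show ?thesis
      using \<open>0 \<le> - _\<close> by (simp only: neg_0_le_iff_le mult_le_0_iff) linarith
  qed
  \<comment> \<open>For \<alpha> = 1 the sinh quotient vanishes and \<open>?g b\<close> would be
    1/2. Otherwise \<open>\<alpha> - 1\<close> lies strictly between 0 and 1, as the monotonicity
    lemma requires.\<close>
  have "\<alpha> \<noteq> 1"
    using gb by auto
  then have "sinh ((\<alpha> - 1) * b) / sinh b < sinh ((\<alpha> - 1) * a) / sinh a"
    using \<alpha> a' b' by (intro sinh_ratio_strict_decreasing) auto
  then have "\<kappa> * (sinh ((\<alpha> - 1) * b) / sinh b) < \<kappa> * (sinh ((\<alpha> - 1) * a) / sinh a)"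
    using \<kappa> by (intro mult_strict_left_mono) auto
  then show False
    using ga gb by linarith
qed

end

section \<open>The moment at zero and the central binomial coefficient\<close>

lemma Gamma_legendre_duplication_real:
  fixes x :: real
  assumes "0 < x"
  shows "Gamma x * Gamma (x + 1 / 2) = 2 powr (1 - 2 * x) * sqrt pi * Gamma (2 * x)"
proof -
  have "(of_real x :: complex) \<notin> \<int>\<^sub>\<le>\<^sub>0" "(of_real x + 1 / 2 :: complex) \<notin> \<int>\<^sub>\<le>\<^sub>0"
    using assms by (auto elim!: nonpos_Ints_cases simp: complex_eq_iff)
  from Gamma_legendre_duplication[OF this]
  have "complex_of_real (Gamma x * Gamma (x + 1 / 2)) = of_real (exp ((1 - 2 * x) * ln 2) * sqrt pi * Gamma (2 * x))"
    by (simp add: Gamma_complex_of_real[symmetric] exp_of_real[symmetric])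
  then show ?thesis
    by (simp only: of_real_eq_iff) (simp add: powr_def)
qed

text \<open>Substitute x = (1 + cos \<theta>) / 2. The Jacobian is sqrt (x (1 - x)), which turns the
  Beta integrand into \<open>x powr q\<close>.\<close>

lemma cos_moment_0_Beta:
  assumes "0 < q"
  shows "cos_moment q 0 = 2 powr q * Beta (q + 1 / 2) (1 / 2)"
proof -
  let ?g = "\<lambda>\<theta>. (1 + cos \<theta>) / 2 :: real" and ?g' = "\<lambda>\<theta>. - sin \<theta> / 2 :: real"
  let ?f = "\<lambda>x. x powr (q + 1 / 2 - 1) * (1 - x) powr (1 / 2 - 1) :: real"
  have "(?f has_integral Beta (q + 1 / 2) (1 / 2)) {0<..<1}"
    using has_integral_Beta_real[of "q + 1 / 2" "1 / 2"] assms by (simp add: has_integral_Icc_iff_Ioo)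
  then have "?f absolutely_integrable_on {0<..<1} \<and> integral {0<..<1} ?f = Beta (q + 1 / 2) (1 / 2)"
    by (auto simp: has_integral_iff intro!: nonnegative_absolutely_integrable_1)
  moreover have "?g ` {0<..<pi} = {0<..<1}"
  proof (intro set_eqI iffI)
    fix x :: real assume "x \<in> ?g ` {0<..<pi}"
    then obtain \<theta> where \<theta>: "0 < \<theta>" "\<theta> < pi" "x = ?g \<theta>" by auto
    then show "x \<in> {0<..<1}"
      using cos_monotone_0_pi[of 0 \<theta>] cos_monotone_0_pi[of \<theta> pi] by auto
  next
    fix x :: real assume "x \<in> {0<..<1}"
    then have "x = ?g (arccos (2 * x - 1))" "arccos (2 * x - 1) \<in> {0<..<pi}"
      using arccos_lt_bounded[of "2 * x - 1"] by auto
    then show "x \<in> ?g ` {0<..<pi}" by blast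
  qed
  moreover have "inj_on ?g {0<..<pi}"
    by (rule inj_onI) (auto intro: cos_inj_pi)
  moreover have "(?g has_field_derivative ?g' \<theta>) (at \<theta> within {0<..<pi})" for \<theta>
    by (auto intro!: derivative_eq_intros)
  ultimately have "integral {0<..<pi} (\<lambda>\<theta>. \<bar>?g' \<theta>\<bar> *\<^sub>R ?f (?g \<theta>)) = Beta (q + 1 / 2) (1 / 2)"
    using has_absolute_integral_change_of_variables_1'[of "{0<..<pi}" ?g ?g' ?f "Beta (q + 1 / 2) (1 / 2)"]
    by simp
  also have "integral {0<..<pi} (\<lambda>\<theta>. \<bar>?g' \<theta>\<bar> *\<^sub>R ?f (?g \<theta>)) = integral {0<..<pi} (\<lambda>\<theta>. ?g \<theta> powr q)"
  proof (rule integral_cong)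
    fix \<theta> :: real assume \<theta>: "\<theta> \<in> {0<..<pi}"
    define x where "x = ?g \<theta>"
    have x: "0 < x" "x < 1"
      using \<theta> cos_monotone_0_pi[of 0 \<theta>] cos_monotone_0_pi[of \<theta> pi] by (auto simp: x_def)
    have "0 < sin \<theta>"
      using \<theta> sin_gt_zero by auto
    have "(sin \<theta> / 2)\<^sup>2 = x * (1 - x)"
      by (simp add: x_def field_simps sin_squared_eq) (simp add: power2_eq_square)
    then have "\<bar>?g' \<theta>\<bar> = sqrt (x * (1 - x))"
      using \<open>0 < sin \<theta>\<close> by (intro real_sqrt_unique[symmetric]) auto
    also have "\<dots> = x powr (1 / 2) * (1 - x) powr (1 / 2)"
      using x by (simp add: real_sqrt_mult powr_half_sqrt)
    finally have "\<bar>?g' \<theta>\<bar> *\<^sub>R ?f x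
        = (x powr (1 / 2) * x powr (q + 1 / 2 - 1)) * ((1 - x) powr (1 / 2) * (1 - x) powr (1 / 2 - 1))"
      by simp
    also have "\<dots> = x powr q"
      using x by (simp only: powr_add[symmetric]) simp
    finally show "\<bar>?g' \<theta>\<bar> *\<^sub>R ?f (?g \<theta>) = ?g \<theta> powr q"
      by (simp only: x_def)
  qed
  also have "\<dots> = integral {0..pi} (\<lambda>\<theta>. (1 + cos \<theta>) powr q / 2 powr q)"
    by (subst integral_open_interval_real) (simp add: powr_divide)
  also have "\<dots> = cos_moment q 0 / 2 powr q"
    by (simp add: cos_moment_def)
  finally show ?thesis
    by (simp add: field_simps)
qed

text \<open>The duplication formula at \<open>q + 1 / 2\<close> converts the Beta value into the
  binomial coefficient; this is the equality case \<open>a = b\<close>.\<close>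

lemma cos_moment_0:
  assumes "0 < q"
  shows "2 powr q * cos_moment q 0 = gen_binomial (2 * q) q * pi"
proof -
  have "Gamma (q + 1 / 2) * Gamma (q + 1) = 2 powr (- 2 * q) * sqrt pi * Gamma (2 * q + 1)"
    using Gamma_legendre_duplication_real[of "q + 1 / 2"] assms by (simp add: add_ac)
  moreover have "0 < Gamma (q + 1)"
    by (rule Gamma_real_pos) (use assms in simp)
  ultimately have *: "Gamma (q + 1 / 2) = 2 powr (- 2 * q) * sqrt pi * Gamma (2 * q + 1) / Gamma (q + 1)"
    by (simp add: nonzero_eq_divide_eq)
  have "2 powr q * cos_moment q 0 = 2 powr q * 2 powr q * (Gamma (q + 1 / 2) * sqrt pi / Gamma (q + 1))"
    using assms by (simp add: cos_moment_0_Beta Beta_def Gamma_one_half_real add_ac)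
  also have "\<dots> = (2 powr q * 2 powr q * 2 powr (- 2 * q)) * (sqrt pi * sqrt pi)
      * (Gamma (2 * q + 1) / (Gamma (q + 1) * Gamma (q + 1)))"
    unfolding * by simp
  also have "2 powr q * 2 powr q * 2 powr (- 2 * q) = (1 :: real)"
    by (simp add: powr_add[symmetric])
  finally show ?thesis
    by (simp add: gen_binomial_def)
qed

lemma gen_binomial_pos: "0 < q \<Longrightarrow> 0 < gen_binomial (2 * q) q"
  by (auto simp: gen_binomial_def intro!: divide_pos_pos mult_pos_pos Gamma_real_pos)

lemma two_powr_energy_exponent: "0 < q \<Longrightarrow> 2 powr energy_exponent q = gen_binomial (2 * q) q"
  by (simp add: energy_exponent_def gen_binomial_pos)

lemma energy_exponent_1: "energy_exponent 1 = 1"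
  using Gamma_fact[of 2, where ?'a = real] Gamma_fact[of 1, where ?'a = real]
  by (simp add: energy_exponent_def gen_binomial_def)

text \<open>Compare the exact moment at zero with its two elementary bounds. The result places
  \<open>2 * q / r\<close> in the range [1, 2) required by \<open>log_gap\<close>.\<close>

lemma energy_exponent_bounds:
  assumes "1 < q"
  shows "q < energy_exponent q" "energy_exponent q \<le> 2 * q"
proof -
  have "2 powr q * pi < 2 powr q * cos_moment q 0"
    using cos_moment_0_lower[OF assms] by simp
  also have "\<dots> = 2 powr energy_exponent q * pi"
    using assms by (simp add: cos_moment_0 two_powr_energy_exponent)
  finally show "q < energy_exponent q" by simp
  have "2 powr energy_exponent q * pi = 2 powr q * cos_moment q 0"
    using assms by (simp add: cos_moment_0 two_powr_energy_exponent)
  also have "\<dots> \<le> 2 powr (2 * q) * pi"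
    using cos_moment_0_upper assms by simp
  finally show "energy_exponent q \<le> 2 * q" by simp
qed

section \<open>The two-point inequality for circle means\<close>

text \<open>The base is |a + e^(i \<theta>) b|^2 for real \<open>a\<close> and \<open>b\<close>, and
  averaging over the half circle equals averaging over the whole one.\<close>

definition circle_mean :: "real \<Rightarrow> real \<Rightarrow> real \<Rightarrow> real" where
  "circle_mean q a b = integral {0..pi} (\<lambda>\<theta>. (a\<^sup>2 + b\<^sup>2 + 2 * a * b * cos \<theta>) powr q) / pi"

lemma power2_powr: "(x\<^sup>2) powr p = x powr (2 * p)" for x p :: real
  by (simp only: power2_eq_square mult_2 powr_add powr_mult)

lemma circle_mean_eq_cos_moment:
  assumes "0 < a" "0 < b"
  shows "circle_mean q a b = (a * b) powr q * (2 powr q * cos_moment q (ln (a / b)) / pi)"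
proof -
  have "(a\<^sup>2 + b\<^sup>2 + 2 * a * b * cos \<theta>) powr q = (2 * a * b) powr q * (cosh (ln (a / b)) + cos \<theta>) powr q" for \<theta>
  proof -
    have "a\<^sup>2 + b\<^sup>2 + 2 * a * b * cos \<theta> = (2 * a * b) * (cosh (ln (a / b)) + cos \<theta>)"
      using assms by (simp add: cosh_ln_real field_simps power2_eq_square)
    then show ?thesis
      using assms cosh_plus_cos_nonneg[of "ln (a / b)" \<theta>] by (simp only: powr_mult)
  qed
  then show ?thesis
    by (simp add: circle_mean_def cos_moment_def powr_mult mult_ac)
qed

text \<open>The two-point inequality is invariant under scaling, so one may take \<open>a * b = 1\<close> and \<open>a / b = exp t\<close>.\<close>

lemma circle_mean_le:
  assumes "1 \<le> q" "0 \<le> a" "0 \<le> b"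
  defines "r \<equiv> energy_exponent q"
  shows "circle_mean q a b \<le> (a powr (2 * q / r) + b powr (2 * q / r)) powr r"
proof (cases "q = 1")
  \<comment> \<open>Here \<alpha> would be 2, outside the range of \<open>log_gap\<close>. The
    cosine term integrates to zero, and equality holds.\<close>
  case True
  have "((\<lambda>\<theta>. (a\<^sup>2 + b\<^sup>2) + 2 * a * b * cos \<theta>) has_integral pi * (a\<^sup>2 + b\<^sup>2)) {0..pi}"
    by (rule has_integral_cos_0_pi)
  moreover have "0 \<le> a\<^sup>2 + b\<^sup>2 + 2 * a * b * cos \<theta>" for \<theta>
  proof -
    have "a * b * (- 1) \<le> a * b * cos \<theta>"
      using assms by (intro mult_left_mono) auto
    moreover have "0 \<le> (a - b)\<^sup>2" by simp
    ultimately show ?thesis by (simp add: power2_eq_square algebra_simps)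
  qed
  ultimately have "circle_mean q a b = a\<^sup>2 + b\<^sup>2"
    using True by (simp add: circle_mean_def integral_unique)
  then show ?thesis
    using True assms by (simp add: r_def energy_exponent_1)
next
  case False
  then have q: "1 < q" using assms by simp
  have r: "q < r" "r \<le> 2 * q"
    unfolding r_def by (rule energy_exponent_bounds[OF q])+
  define \<alpha> where "\<alpha> = 2 * q / r"
  have bounds: "1 \<le> \<alpha>" "\<alpha> < 2" "\<alpha> * r = 2 * q" "2 * q / \<alpha> = r"
    using q r by (auto simp: \<alpha>_def field_simps)
  interpret log_gap q \<alpha>
    using q bounds by unfold_locales (simp_all add: cos_moment_0 two_powr_energy_exponent r_def)
  show ?thesis
  proof (cases "a = 0 \<or> b = 0")
    case True
    then show ?thesis
    proof
      assume "a = 0"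
      then show ?thesis
        using assms(3) bounds(3) by (simp add: circle_mean_def \<alpha>_def[symmetric] powr_powr power2_powr)
    next
      assume "b = 0"
      then show ?thesis
        using assms(2) bounds(3) by (simp add: circle_mean_def \<alpha>_def[symmetric] powr_powr power2_powr)
    qed
  next
    case False
    then have ab: "0 < a" "0 < b" using assms by auto
    \<comment> \<open>The gap is controlled only for nonnegative arguments; both sides are even in
      \<open>t\<close>.\<close>
    define t where "t = \<bar>ln (a / b)\<bar>"
    have even: "cos_moment q (ln (a / b)) = cos_moment q t" "cosh (\<alpha> * t / 2) = cosh (\<alpha> * ln (a / b) / 2)"
      by (auto simp: cos_moment_def t_def abs_if)
    have "0 \<le> gap t"
      by (rule gap_nonneg) (simp add: t_def)
    then have "ln (2 powr q * cos_moment q t / pi) \<le> ln ((2 * cosh (\<alpha> * t / 2)) powr r)"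
      by (simp add: gap_def bounds ln_powr)
    then have "2 powr q * cos_moment q t / pi \<le> (2 * cosh (\<alpha> * t / 2)) powr r"
      using cos_moment_\<kappa>_pos[of t] by (subst (asm) ln_le_cancel_iff) auto
    then have "circle_mean q a b \<le> (a * b) powr q * (2 * cosh (\<alpha> * t / 2)) powr r"
      unfolding circle_mean_eq_cos_moment[OF ab] even by (intro mult_left_mono) auto
    also have "(a * b) powr q = ((a * b) powr (\<alpha> / 2)) powr r"
      using bounds by (simp add: powr_powr)
    also have "\<dots> * (2 * cosh (\<alpha> * t / 2)) powr r = ((a * b) powr (\<alpha> / 2) * (2 * cosh (\<alpha> * t / 2))) powr r"
      by (simp add: powr_mult)
    also have "(a * b) powr (\<alpha> / 2) * (2 * cosh (\<alpha> * t / 2)) = a powr \<alpha> + b powr \<alpha>"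
    proof -
      \<comment> \<open>In these variables the claim is e^(u+v) (e^(u-v) + e^(v-u)) = e^(2u) +
        e^(2v), which undoes the normalisation.\<close>
      define u v where "u = \<alpha> * ln a / 2" and "v = \<alpha> * ln b / 2"
      have "(a * b) powr (\<alpha> / 2) = exp (u + v)"
        using ab by (simp add: powr_def ln_mult u_def v_def field_simps)
      moreover have "\<alpha> * ln (a / b) / 2 = u - v"
        using ab by (simp add: ln_div u_def v_def field_simps)
      moreover have "2 * cosh (u - v) = exp (u - v) + exp (v - u)"
        by (simp add: cosh_field_def)
      then have "exp (u + v) * (2 * cosh (u - v)) = exp (2 * u) + exp (2 * v)"
        by (simp only: distrib_left exp_add[symmetric]) simp
      moreover have "exp (2 * u) = a powr \<alpha>" "exp (2 * v) = b powr \<alpha>"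
        using ab by (simp_all add: powr_def u_def v_def)
      ultimately show ?thesis
        unfolding even by (simp only:)
    qed
    finally show ?thesis
      by (simp add: \<alpha>_def)
  qed
qed

lemma circle_mean_same:
  assumes "0 < q" "0 \<le> a"
  shows "circle_mean q a a = 2 powr energy_exponent q * a powr (2 * q)"
proof (cases "a = 0")
  case False
  then have "0 < a" using assms by simp
  then have "circle_mean q a a = (a * a) powr q * (gen_binomial (2 * q) q * pi / pi)"
    using assms by (simp add: circle_mean_eq_cos_moment cos_moment_0)
  also have "(a * a) powr q = a powr (2 * q)"
    using power2_powr[of a q] by (simp only: power2_eq_square)
  finally show ?thesis
    using assms by (simp add: two_powr_energy_exponent)
qed (use assms in \<open>simp add: circle_mean_def\<close>)

subsection \<open>Induction on the dimension\<close>

text \<open>Periodicity moves the piece left of 0 by one period, which removes the phase; evenness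
  then folds the full period onto the half period.\<close>

lemma integral_shifted_period:
  fixes G :: "real \<Rightarrow> real"
  assumes cont: "continuous_on UNIV G" and period: "\<And>x. G (x + 2 * pi) = G x" and even: "\<And>x. G (- x) = G x"
    and \<phi>: "0 \<le> \<phi>" "\<phi> \<le> 2 * pi"
  shows "integral {0..1} (\<lambda>t. G (2 * pi * t - \<phi>)) = integral {0..pi} G / pi"
proof -
  have int: "G integrable_on {a..b}" for a b
    by (intro integrable_continuous_real continuous_on_subset[OF cont]) auto
  have "integral {- \<phi>..0} G = integral {- \<phi> + 2 * pi..0 + 2 * pi} G"
    using integral_shift_Icc_real[of "- \<phi>" 0 G "2 * pi"] period
    by (simp add: o_def add.commute)
  then have "integral {- \<phi>..2 * pi - \<phi>} G = integral {0..2 * pi} G"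
    using Henstock_Kurzweil_Integration.integral_combine[of "- \<phi>" 0 "2 * pi - \<phi>" G]
      Henstock_Kurzweil_Integration.integral_combine[of 0 "2 * pi - \<phi>" "2 * pi" G] \<phi> int
    by simp
  also have "\<dots> = integral {0..pi} G + integral {pi..2 * pi} G"
    using Henstock_Kurzweil_Integration.integral_combine[of 0 pi "2 * pi" G] int by simp
  also have "integral {pi..2 * pi} G = integral {- pi..0} G"
    using integral_shift_Icc_real[of "- pi" 0 G "2 * pi"] period
    by (simp add: o_def add.commute)
  also have "integral {- pi..0} G = integral {0..pi} G"
    using Henstock_Kurzweil_Integration.integral_reflect_real[where a = 0 and b = pi and f = G] even by simp
  finally have "(G has_integral 2 * integral {0..pi} G) (cbox (- \<phi>) (2 * pi - \<phi>))"
    using integrable_integral[OF int, of "- \<phi>" "2 * pi - \<phi>"] by simp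
  from has_integral_affinity'[OF this, of "2 * pi" "- \<phi>"]
  have "((\<lambda>t. G (2 * pi * t - \<phi>)) has_integral integral {0..pi} G / pi) {0..1}"
    by (simp add: field_simps)
  then show ?thesis
    by (rule integral_unique)
qed

lemma integral_unit_interval:
  fixes f :: "real \<Rightarrow> real"
  assumes "continuous_on {0..1} f"
  shows "integral\<^sup>L (restrict_space lborel {0..<1}) f = integral {0..1} f"
proof -
  have "set_integrable lborel {0..1} f"
    using assms by (rule borel_integrable_atLeastAtMost')
  then have "set_integrable lborel {0..<1} f"
    by (rule set_integrable_subset) auto
  then have "(LINT t:{0..<1}|lborel. f t) = integral {0..<1} f"
    by (rule set_borel_integral_eq_integral)
  also have "integral {0..<1} f = integral {0..1} f"
    by (rule integral_spike_set) (auto intro: negligible_subset[of "{1}"])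
  finally show ?thesis
    by (simp add: integral_restrict_space set_lebesgue_integral_def)
qed

text \<open>With \<phi> the argument of \<open>cnj z * w\<close>, the squared norm depends on
  \<open>t\<close> only through \<open>cos (2 * pi * t - \<phi>)\<close>, and the phase disappears
  on integrating over a period.\<close>

lemma integral_rotation_eq_circle_mean:
  assumes "0 < q"
  shows "(\<integral>t. norm (z + cis (- 2 * pi * t) * w) powr (2 * q) \<partial>restrict_space lborel {0..<1})
    = circle_mean q (norm z) (norm w)"
proof -
  define \<phi> where "\<phi> = Arg2pi (cnj z * w)"
  define G where "G x = ((norm z)\<^sup>2 + (norm w)\<^sup>2 + 2 * norm z * norm w * cos x) powr q" for x
  have \<phi>: "0 \<le> \<phi>" "\<phi> \<le> 2 * pi"
    using Arg2pi_ge_0 Arg2pi_lt_2pi by (auto simp: \<phi>_def less_imp_le)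
  have arg: "cnj z * w = of_real (norm z * norm w) * cis \<phi>"
    using Arg2pi_eq[of "cnj z * w"] by (simp add: \<phi>_def cis_conv_exp norm_mult)
  have norm2: "(norm (z + cis (- 2 * pi * t) * w))\<^sup>2
      = (norm z)\<^sup>2 + (norm w)\<^sup>2 + 2 * norm z * norm w * cos (2 * pi * t - \<phi>)" for t
  proof -
    have "(norm (z + u))\<^sup>2 = (norm z)\<^sup>2 + (norm u)\<^sup>2 + 2 * Re (cnj z * u)" for u
      unfolding cmod_power2 by (simp add: power2_eq_square algebra_simps)
    then have "(norm (z + cis (- 2 * pi * t) * w))\<^sup>2
        = (norm z)\<^sup>2 + (norm w)\<^sup>2 + 2 * Re (cis (- 2 * pi * t) * (cnj z * w))"
      by (simp add: norm_mult mult.left_commute)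
    also have "cis (- 2 * pi * t) * (cnj z * w) = of_real (norm z * norm w) * cis (\<phi> - 2 * pi * t)"
      unfolding arg by (simp add: cis_mult)
    also have "Re \<dots> = norm z * norm w * cos (2 * pi * t - \<phi>)"
      using cos_minus[of "2 * pi * t - \<phi>"] by simp
    finally show ?thesis
      by simp
  qed
  have G: "norm (z + cis (- 2 * pi * t) * w) powr (2 * q) = G (2 * pi * t - \<phi>)" for t
    by (simp add: G_def norm2[symmetric] power2_powr)
  have "continuous_on UNIV G"
  proof -
    \<comment> \<open>Every real \<open>x\<close> has the form \<open>2 * pi * t - \<phi>\<close>,
      where the expression is a squared norm.\<close>
    have "0 \<le> (norm z)\<^sup>2 + (norm w)\<^sup>2 + 2 * norm z * norm w * cos x" for x
      using norm2[of "(x + \<phi>) / (2 * pi)"] zero_le_power2[of "norm (z + cis (- 2 * pi * ((x + \<phi>) / (2 * pi))) * w)"]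
      by simp
    then show ?thesis
      unfolding G_def[abs_def] using assms by (intro continuous_on_powr' continuous_intros) auto
  qed
  note cont = continuous_on_compose2[OF this]
  have "integral\<^sup>L (restrict_space lborel {0..<1}) (\<lambda>t. G (2 * pi * t - \<phi>))
      = integral {0..1} (\<lambda>t. G (2 * pi * t - \<phi>))"
    by (intro integral_unit_interval cont continuous_intros) auto
  also have "\<dots> = integral {0..pi} G / pi"
    by (intro integral_shifted_period \<phi> \<open>continuous_on UNIV G\<close>) (simp_all add: G_def)
  finally show ?thesis
    unfolding G circle_mean_def G_def[abs_def] .
qed

section \<open>Trigonometric sums on the torus\<close>

definition trig :: "nat \<Rightarrow> (nat \<Rightarrow> int) set \<Rightarrow> (nat \<Rightarrow> real) \<Rightarrow> complex" where
  "trig d A \<xi> = (\<Sum>x\<in>A. cis (- 2 * pi * (\<Sum>j<d. of_int (x j) * \<xi> j)))"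

lemma additive_energy_trig: "additive_energy d q A = (\<integral>\<xi>. norm (trig d A \<xi>) powr (2 * q) \<partial>torus d)"
  by (simp add: additive_energy_def trig_def)

lemma borel_measurable_component_torus [measurable]:
  assumes "j < d"
  shows "(\<lambda>\<xi>. \<xi> j) \<in> borel_measurable (torus d)"
proof -
  have "(\<lambda>\<xi>. \<xi> j) \<in> measurable (torus d) (restrict_space lborel {0..<1})"
    unfolding torus_def using assms by (intro measurable_component_singleton) auto
  moreover have "(\<lambda>x. x) \<in> measurable (restrict_space lborel {0..<1}) (borel :: real measure)"
    by (intro measurable_restrict_space1) simp
  ultimately show ?thesis
    using measurable_compose by blast
qed

lemma borel_measurable_trig [measurable]: "trig d A \<in> borel_measurable (torus d)"
proof -
  have "cis \<in> borel_measurable borel"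
    by (intro borel_measurable_continuous_onI continuous_intros)
  then have "(\<lambda>\<xi>. cis (- 2 * pi * (\<Sum>j<d. of_int (x j) * \<xi> j))) \<in> borel_measurable (torus d)" for x :: "nat \<Rightarrow> int"
    by (rule measurable_compose[rotated]) (intro borel_measurable_times borel_measurable_sum borel_measurable_const
        borel_measurable_component_torus, simp)
  then show ?thesis
    unfolding trig_def[abs_def] by (intro borel_measurable_sum)
qed

lemma norm_trig_le: "norm (trig d A \<xi>) \<le> card A"
  unfolding trig_def by (rule order_trans[OF norm_sum]) simp

lemma integrable_trig_powr:
  assumes "0 \<le> q"
  shows "integrable (torus d) (\<lambda>\<xi>. norm (trig d A \<xi>) powr q)"
proof -
  interpret prob_space "torus d" by (rule prob_space_torus)
  show ?thesis
    by (rule integrable_const_bound[where B = "real (card A) powr q"])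
      (auto intro!: powr_mono2 assms norm_trig_le)
qed

section \<open>Slices along the last coordinate\<close>

text \<open>Elements are kept extensional on \<open>{..<d}\<close>: coordinate \<open>d\<close> is
  reset to \<open>undefined\<close>, so the update \<open>y(d := b)\<close> is injective on a
  slice.\<close>

definition slice :: "nat \<Rightarrow> int \<Rightarrow> (nat \<Rightarrow> int) set \<Rightarrow> (nat \<Rightarrow> int) set" where
  "slice d b A = {y \<in> binary_cube d. y(d := b) \<in> A}"

lemma finite_binary_cube: "finite (binary_cube d)"
  by (auto simp: binary_cube_def intro: finite_PiE)

lemma card_binary_cube: "card (binary_cube d) = 2 ^ d"
  by (simp add: binary_cube_def card_PiE numeral_2_eq_2)

lemma slice_subset: "slice d b A \<subseteq> binary_cube d"
  by (auto simp: slice_def)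

lemma finite_slice: "finite (slice d b A)"
  using finite_subset[OF slice_subset finite_binary_cube] .

lemma binary_cube_Suc: "binary_cube (Suc d) = (\<lambda>(b, y). y(d := b)) ` ({0, 1} \<times> binary_cube d)"
  unfolding binary_cube_def lessThan_Suc by (rule PiE_insert_eq)

lemma inj_on_fun_upd_binary_cube: "inj_on (\<lambda>y. y(d := b)) (binary_cube d)"
  unfolding binary_cube_def by (rule inj_onI) (metis PiE_arb fun_upd_triv fun_upd_upd lessThan_iff less_irrefl)

lemma decompose_slices:
  assumes "A \<subseteq> binary_cube (Suc d)"
  shows "A = (\<lambda>y. y(d := 0)) ` slice d 0 A \<union> (\<lambda>y. y(d := 1)) ` slice d 1 A"
proof (intro equalityI subsetI)
  fix x assume "x \<in> A"
  then have "x \<in> (\<lambda>(b, y). y(d := b)) ` ({0, 1} \<times> binary_cube d)"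
    using assms binary_cube_Suc by blast
  then obtain b y where "b \<in> {0, 1}" "y \<in> binary_cube d" "x = y(d := b)"
    by auto
  then show "x \<in> (\<lambda>y. y(d := 0)) ` slice d 0 A \<union> (\<lambda>y. y(d := 1)) ` slice d 1 A"
    using \<open>x \<in> A\<close> by (auto simp: slice_def)
qed (auto simp: slice_def)

lemma sum_slices:
  assumes "A \<subseteq> binary_cube (Suc d)"
  shows "sum f A = (\<Sum>y\<in>slice d 0 A. f (y(d := 0))) + (\<Sum>y\<in>slice d 1 A. f (y(d := 1)))"
proof -
  have inj: "inj_on (\<lambda>y. y(d := b)) (slice d c A)" for b c
    by (rule inj_on_subset[OF inj_on_fun_upd_binary_cube slice_subset])
  have disj: "(\<lambda>y. y(d := 0)) ` slice d 0 A \<inter> (\<lambda>y. y(d := 1)) ` slice d 1 A = {}"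
    by (auto dest!: fun_cong[of _ _ d])
  show ?thesis
    by (subst decompose_slices[OF assms])
      (simp add: sum.union_disjoint disj finite_slice sum.reindex inj)
qed

lemma card_slices:
  assumes "A \<subseteq> binary_cube (Suc d)"
  shows "card A = card (slice d 0 A) + card (slice d 1 A)"
  using sum_slices[OF assms, of "\<lambda>_. 1 :: nat"] by simp

lemma trig_Suc:
  assumes "A \<subseteq> binary_cube (Suc d)"
  shows "trig (Suc d) A (\<xi>(d := t)) = trig d (slice d 0 A) \<xi> + cis (- 2 * pi * t) * trig d (slice d 1 A) \<xi>"
proof -
  have "(\<Sum>j<Suc d. of_int ((y(d := b)) j) * (\<xi>(d := t)) j) = (\<Sum>j<d. of_int (y j) * \<xi> j) + of_int b * t"
    for y :: "nat \<Rightarrow> int" and b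
    by simp
  then show ?thesis
    unfolding trig_def sum_slices[OF assms]
    by (simp add: sum_distrib_left cis_mult algebra_simps)
qed

text \<open>Fubini isolates the last coordinate, in which the trigonometric sum is a rotation of one
  slice sum added to the other.\<close>

lemma additive_energy_Suc:
  assumes "A \<subseteq> binary_cube (Suc d)" "0 < q"
  shows "additive_energy (Suc d) q A
    = (\<integral>\<xi>. circle_mean q (norm (trig d (slice d 0 A) \<xi>)) (norm (trig d (slice d 1 A) \<xi>)) \<partial>torus d)"
proof -
  interpret product_sigma_finite "\<lambda>_ :: nat. restrict_space lborel {0 :: real..<1}"
    by (intro product_sigma_finite.intro prob_space_imp_sigma_finite prob_spaceI)
      (simp add: space_restrict_space emeasure_restrict_space)
  have "additive_energy (Suc d) q A
      = (\<integral>\<xi>. \<integral>t. norm (trig (Suc d) A (\<xi>(d := t))) powr (2 * q) \<partial>restrict_space lborel {0..<1} \<partial>torus d)"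
    unfolding additive_energy_trig
    using product_integral_insert[of "{..<d}" d "\<lambda>\<xi>. norm (trig (Suc d) A \<xi>) powr (2 * q)"]
      integrable_trig_powr[of "2 * q" "Suc d" A] assms
    by (simp add: torus_def lessThan_Suc)
  then show ?thesis
    by (simp only: trig_Suc[OF assms(1)] integral_rotation_eq_circle_mean[OF assms(2)])
qed

section \<open>The energy bound and its equality cases\<close>

text \<open>The sum is empty or a single unimodular term, so any exponent \<open>r\<close> serves;
  in the empty case \<open>0 powr r = 0\<close>.\<close>

lemma additive_energy_le_1:
  assumes "card A \<le> 1" "finite A"
  shows "additive_energy d q A = real (card A) powr r"
proof (cases "A = {}")
  case False
  then obtain x where "x \<in> A" by blast
  then have "A = {x}"
    using assms card_le_Suc0_iff_eq[of A] by auto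
  then show ?thesis
    using prob_space.prob_space[OF prob_space_torus] by (simp add: additive_energy_def)
qed (simp add: additive_energy_def)

lemma additive_energy_le:
  assumes "1 \<le> q" "A \<subseteq> binary_cube d"
  shows "additive_energy d q A \<le> real (card A) powr energy_exponent q"
  using assms(2)
proof (induction d arbitrary: A)
  case 0
  then have "card A \<le> 1" "finite A"
    using card_mono[OF finite_binary_cube 0] finite_subset[OF _ finite_binary_cube]
    by (auto simp: card_binary_cube)
  then show ?case
    by (rule eq_refl[OF additive_energy_le_1])
next
  case (Suc d)
  define r where "r = energy_exponent q"
  have r: "1 \<le> r"
    using energy_exponent_bounds[of q] energy_exponent_1 assms by (cases "q = 1") (auto simp: r_def)
  define f where "f b \<xi> = norm (trig d (slice d b A) \<xi>)" for b \<xi>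
  define n where "n b = real (card (slice d b A))" for b
  have IH: "(\<integral>\<xi>. f b \<xi> powr (2 * q) \<partial>torus d) \<le> n b powr r" for b
    using Suc.IH[OF slice_subset, of b A] by (simp add: additive_energy_trig f_def n_def r_def)
  have int: "integrable (torus d) (\<lambda>\<xi>. f b \<xi> powr (2 * q))" for b
    unfolding f_def using assms by (intro integrable_trig_powr) auto
  have f_nonneg: "0 \<le> f b \<xi>" for b \<xi>
    by (simp add: f_def)
  have f_0: "f b \<xi> = 0" if "n b = 0" for b \<xi>
    using that by (simp add: f_def n_def finite_slice trig_def)
  have two_point: "circle_mean q (f 0 \<xi>) (f 1 \<xi>) \<le> (f 0 \<xi> powr (2 * q / r) + f 1 \<xi> powr (2 * q / r)) powr r" for \<xi>
    unfolding r_def by (intro circle_mean_le assms(1) f_nonneg)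
  have pw: "(f b \<xi> powr (2 * q / r)) powr r = f b \<xi> powr (2 * q)" for b \<xi>
    using r by (simp add: powr_powr)
  have card: "real (card A) = n 0 + n 1"
    by (simp add: card_slices[OF Suc.prems] n_def)
  have energy: "additive_energy (Suc d) q A = (\<integral>\<xi>. circle_mean q (f 0 \<xi>) (f 1 \<xi>) \<partial>torus d)"
    using additive_energy_Suc[OF Suc.prems] assms by (simp add: f_def)
  \<comment> \<open>Jensen's inequality needs positive weights. If a slice is empty, its sum
    vanishes and the two-point bound reduces to the other slice.\<close>
  consider "n 0 = 0" | "n 1 = 0" | "0 < n 0" "0 < n 1"
    by (fastforce simp: n_def)
  then have "additive_energy (Suc d) q A \<le> (n 0 + n 1) powr r"
  proof cases
    case 1
    then have "circle_mean q (f 0 \<xi>) (f 1 \<xi>) \<le> f 1 \<xi> powr (2 * q)" for \<xi>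
      using two_point[of \<xi>] f_0[of 0 \<xi>] pw[of 1 \<xi>] by simp
    then have "additive_energy (Suc d) q A \<le> (\<integral>\<xi>. f 1 \<xi> powr (2 * q) \<partial>torus d)"
      unfolding energy by (intro integral_mono' int) auto
    then show ?thesis
      using IH[of 1] 1 by simp
  next
    case 2
    then have "circle_mean q (f 0 \<xi>) (f 1 \<xi>) \<le> f 0 \<xi> powr (2 * q)" for \<xi>
      using two_point[of \<xi>] f_0[of 1 \<xi>] pw[of 0 \<xi>] by simp
    then have "additive_energy (Suc d) q A \<le> (\<integral>\<xi>. f 0 \<xi> powr (2 * q) \<partial>torus d)"
      unfolding energy by (intro integral_mono' int) auto
    then show ?thesis
      using IH[of 0] 2 by simp
  next
    case 3
    \<comment> \<open>Weighting by the slice cardinalities is what closes the induction: the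
      hypothesis turns each summand into \<open>n b powr (1 - r) * n b powr r = n b\<close>.\<close>
    let ?g = "\<lambda>\<xi>. (n 0 + n 1) powr (r - 1) * (n 0 powr (1 - r) * f 0 \<xi> powr (2 * q) + n 1 powr (1 - r) * f 1 \<xi> powr (2 * q))"
    have "circle_mean q (f 0 \<xi>) (f 1 \<xi>) \<le> ?g \<xi>" for \<xi>
      using two_point[of \<xi>] powr_sum_le_weighted[OF r 3, of "f 0 \<xi> powr (2 * q / r)" "f 1 \<xi> powr (2 * q / r)"]
      by (simp add: pw)
    then have "additive_energy (Suc d) q A \<le> (\<integral>\<xi>. ?g \<xi> \<partial>torus d)"
      unfolding energy
      by (intro integral_mono' integrable_mult_right Bochner_Integration.integrable_add int) auto
    also have "\<dots> = (n 0 + n 1) powr (r - 1) * (n 0 powr (1 - r) * (\<integral>\<xi>. f 0 \<xi> powr (2 * q) \<partial>torus d)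
        + n 1 powr (1 - r) * (\<integral>\<xi>. f 1 \<xi> powr (2 * q) \<partial>torus d))"
      using int by (simp add: Bochner_Integration.integral_add)
    also have "\<dots> \<le> (n 0 + n 1) powr (r - 1) * (n 0 powr (1 - r) * n 0 powr r + n 1 powr (1 - r) * n 1 powr r)"
      by (intro mult_left_mono add_mono IH) auto
    also have "\<dots> = (n 0 + n 1) powr (r - 1) * (n 0 + n 1)"
      using 3 by (simp add: powr_add[symmetric])
    also have "\<dots> = (n 0 + n 1) powr r"
      using 3 powr_add[of "n 0 + n 1" "r - 1" 1] by simp
    finally show ?thesis .
  qed
  then show ?case
    by (simp add: card r_def)
qed

lemma slice_binary_cube: "b \<in> {0, 1} \<Longrightarrow> slice d b (binary_cube (Suc d)) = binary_cube d"
  unfolding slice_def binary_cube_Suc by (auto simp only: intro!: image_eqI[where x = "(b, _)"])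

text \<open>Both slices are the cube one dimension lower, so the two moduli coincide at every point;
  each added dimension multiplies the energy by exactly
  \<open>2 powr energy_exponent q\<close>.\<close>

lemma additive_energy_binary_cube:
  assumes "0 < q"
  shows "additive_energy d q (binary_cube d) = real (card (binary_cube d)) powr energy_exponent q"
proof (induction d)
  case 0
  then show ?case
    by (intro additive_energy_le_1 finite_binary_cube) (simp add: card_binary_cube)
next
  case (Suc d)
  have "additive_energy (Suc d) q (binary_cube (Suc d)) = 2 powr energy_exponent q * additive_energy d q (binary_cube d)"
    unfolding additive_energy_Suc[OF subset_refl assms] additive_energy_trig[of d] using assms
    by (simp add: slice_binary_cube circle_mean_same)
  also have "\<dots> = real (card (binary_cube (Suc d))) powr energy_exponent q"
    unfolding Suc.IH card_binary_cube by (simp add: powr_mult)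
  finally show ?case .
qed

theorem corollary2:
  fixes \<kappa> :: real and d :: nat
  assumes "1 \<le> \<kappa>" and "1 \<le> d"
  shows "(\<forall>A. A \<subseteq> binary_cube d \<longrightarrow>
            additive_energy d \<kappa> A \<le> real (card A) powr energy_exponent \<kappa>) \<and>
         (\<forall>A. A \<subseteq> binary_cube d \<and> card A \<le> 1 \<longrightarrow>
            additive_energy d \<kappa> A = real (card A) powr energy_exponent \<kappa>) \<and>
         (\<exists>A. A \<subseteq> binary_cube d \<and> card A > 1 \<and>
            additive_energy d \<kappa> A = real (card A) powr energy_exponent \<kappa>) \<and>
         additive_energy d \<kappa> (binary_cube d) = real (card (binary_cube d)) powr energy_exponent \<kappa>"
proof (intro conjI allI impI)
  show cube: "additive_energy d \<kappa> (binary_cube d) = real (card (binary_cube d)) powr energy_exponent \<kappa>"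
    using assms by (intro additive_energy_binary_cube) auto
  \<comment> \<open>Since \<open>d\<close> is positive, the cube itself witnesses equality with more
    than one element.\<close>
  have "1 < card (binary_cube d)"
    using assms one_less_power[of "2 :: nat" d] by (simp add: card_binary_cube)
  then show "\<exists>A. A \<subseteq> binary_cube d \<and> card A > 1 \<and>
      additive_energy d \<kappa> A = real (card A) powr energy_exponent \<kappa>"
    using cube by blast
next
  fix A assume "A \<subseteq> binary_cube d"
  then show "additive_energy d \<kappa> A \<le> real (card A) powr energy_exponent \<kappa>"
    by (rule additive_energy_le[OF assms(1)])
next
  fix A assume "A \<subseteq> binary_cube d \<and> card A \<le> 1"
  then show "additive_energy d \<kappa> A = real (card A) powr energy_exponent \<kappa>"
    using finite_subset[OF _ finite_binary_cube] by (intro additive_energy_le_1) auto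
qed

end
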